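(* Let $(x_k)_{k\in\mathbb{Z}}$ be the stationary iterates of stochastic gradient descent with momentum (SGDM) with stepsize $\gamma>0$ and momentum $\alpha\in[0,1)$ under the zero-th order noise model, with indices sampled with replacement (all defined in the context). If $(1-\alpha)^2+\gamma^2\lambda_i^2-2(1+\alpha)\gamma\lambda_i\ge 0$ for all $i\in\{1,\dots,d\}$, then $$\mathrm{Tr}[\mathrm{Var}(x_k)]=\gamma^2\sum_{i=1}^d (u_i^\top\Sigma u_i)\,\frac{\sqrt{\rho_+^i}-\sqrt{\rho_-^i}-\frac{1}{\sqrt{\rho_+^i}}+\frac{1}{\sqrt{\rho_-^i}}}{4(1-\alpha)\sqrt{(1-\alpha)^2+\gamma^2\lambda_i^2-2(1+\alpha)\gamma\lambda_i}},$$ where $$\rho_\pm^i=\frac{2(1-\alpha)^2+\gamma^2\lambda_i^2-2(1+\alpha)\gamma\lambda_i\pm 2(1-\alpha)\sqrt{(1-\alpha)^2+\gamma^2\lambda_i^2-2(1+\alpha)\gamma\lambda_i}}{\gamma^2\lambda_i^2}.$$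
   Context: Let $A_1,\dots,A_n\in\mathbb{R}^{d\times d}$ be symmetric and $b_1,\dots,b_n\in\mathbb{R}^d$; put $A=\frac1n\sum_i A_i$, assumed strictly positive definite, $b=\frac1n\sum_i b_i$, $x^\star=-A^{-1}b$, $y_i=-A_iA^{-1}b+b_i$ (so $\sum_i y_i=0$), $\Sigma=\frac1n\sum_{i=1}^n y_iy_i^\top$. Let $(u_i)_{i=1}^d$ be an orthonormal basis of eigenvectors of $A$, $Au_i=\lambda_iu_i$, $\lambda_i>0$. Zero-th order noise model: the gradient of $f_i(x)=\frac12x^\top A_ix+b_i^\top x$ is replaced by $\widehat{\nabla f_i}(x)=Ax+y_i+b$. SGDM: $x_{k+1}=x_k+\alpha(x_k-x_{k-1})-\gamma\widehat{\nabla f_{i_k}}(x_k)$; equivalently, with $\Delta x_k=x_k-x^\star$, $\Delta x_{k+1}=((1+\alpha)\mathrm{Id}-\gamma A)\Delta x_k-\alpha\Delta x_{k-1}-\gamma y_{i_k}$. Sampling with replacement: $(i_k)_{k\in\mathbb{Z}}$ are i.i.d. uniform on $\{1,\dots,n\}$. Stationary iterates: $(\Delta x_k)_k$ is the output of the linear time-invariant system with input $(y_{i_k})_k$ defined by this recursion, i.e. $\Delta x_k=\sum_{j\in\mathbb{Z}}H_{k-j}\,y_{i_j}$, where $(H_k)_{k\in\mathbb{Z}}$ are the matrices with $\sum_k H_kz^{-k}=H(z):=-\gamma z\,(z^2\mathrm{Id}-z((1+\alpha)\mathrm{Id}-\gamma A)+\alpha\mathrm{Id})^{-1}$ for $|z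|=1$.
   Formalization: When $(1-\alpha)^2+\gamma^2\lambda_i^2-2(1+\alpha)\gamma\lambda_i=0$ the printed fraction is $0/0$; there it is read as its limit as the eigenvalue argument tends to $\lambda_i$ through values where this quantity is positive. *)

theory Defs
  imports "HOL-Probability.Probability"
begin

section \<open>The quadratic finite-sum problem\<close>

definition emp_mean :: "nat \<Rightarrow> (nat \<Rightarrow> 'a::real_vector) \<Rightarrow> 'a" where
  "emp_mean n f = (1 / real n) *\<^sub>R (\<Sum>i = 1..n. f i)"

definition x_star :: "nat \<Rightarrow> (nat \<Rightarrow> real^'d^'d) \<Rightarrow> (nat \<Rightarrow> real^'d) \<Rightarrow> real^'d" where
  "x_star n As bs = - (matrix_inv (emp_mean n As) *v emp_mean n bs)"

definition y_noise :: "nat \<Rightarrow> (nat \<Rightarrow> real^'d^'d) \<Rightarrow> (nat \<Rightarrow> real^'d) \<Rightarrow> nat \<Rightarrow> real^'d" where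
  "y_noise n As bs i = - (As i *v (matrix_inv (emp_mean n As) *v emp_mean n bs)) + bs i"

definition outer :: "real^'d \<Rightarrow> real^'d^'d" where
  "outer v = (\<chi> r c. v $ r * v $ c)"

definition Sigma_mat :: "nat \<Rightarrow> (nat \<Rightarrow> real^'d^'d) \<Rightarrow> (nat \<Rightarrow> real^'d) \<Rightarrow> real^'d^'d" where
  "Sigma_mat n As bs = emp_mean n (\<lambda>i. outer (y_noise n As bs i))"

definition symmetric_mat :: "real^'d^'d \<Rightarrow> bool" where
  "symmetric_mat A \<longleftrightarrow> transpose A = A"

definition strictly_pos_def :: "real^'d^'d \<Rightarrow> bool" where
  "strictly_pos_def A \<longleftrightarrow> symmetric_mat A \<and> (\<forall>v. v \<noteq> 0 \<longrightarrow> v \<bullet> (A *v v) > 0)"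


section \<open>Stationary iterates of SGDM under the zero-th order noise model\<close>

definition grad_hat ::
  "nat \<Rightarrow> (nat \<Rightarrow> real^'d^'d) \<Rightarrow> (nat \<Rightarrow> real^'d) \<Rightarrow> nat \<Rightarrow> real^'d \<Rightarrow> real^'d" where
  "grad_hat n As bs i x = emp_mean n As *v x + y_noise n As bs i + emp_mean n bs"

definition complex_mat :: "real^'d^'d \<Rightarrow> complex^'d^'d" where
  "complex_mat A = (\<chi> r c. complex_of_real (A $ r $ c))"

text \<open>For a scalar \<open>c\<close>, the matrix \<open>c Id\<close> is \<open>mat c\<close>, and \<open>c M\<close> is written \<open>mat c ** M\<close>.\<close>

definition sgdm_pencil :: "real \<Rightarrow> real \<Rightarrow> real^'d^'d \<Rightarrow> complex \<Rightarrow> complex^'d^'d" where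
  "sgdm_pencil \<alpha> \<gamma> A z =
     mat (z\<^sup>2) - mat z ** complex_mat (mat (1 + \<alpha>) - \<gamma> *\<^sub>R A) + mat (of_real \<alpha>)"

definition sgdm_transfer :: "real \<Rightarrow> real \<Rightarrow> real^'d^'d \<Rightarrow> complex \<Rightarrow> complex^'d^'d" where
  "sgdm_transfer \<alpha> \<gamma> A z = mat (- of_real \<gamma> * z) ** matrix_inv (sgdm_pencil \<alpha> \<gamma> A z)"

text \<open>The defining relation of the matrices \<open>H k\<close>. Invertibility says that the transfer function is
  well defined on the unit circle; no stability is assumed, and \<open>H\<close> may be two-sided.\<close>

definition sgdm_impulse_response ::
  "real \<Rightarrow> real \<Rightarrow> real^'d^'d \<Rightarrow> (int \<Rightarrow> real^'d^'d) \<Rightarrow> bool" where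
  "sgdm_impulse_response \<alpha> \<gamma> A H \<longleftrightarrow>
     (\<forall>z. cmod z = 1 \<longrightarrow>
        invertible (sgdm_pencil \<alpha> \<gamma> A z) \<and>
        ((\<lambda>k. mat (z powi (- k)) ** complex_mat (H k)) has_sum sgdm_transfer \<alpha> \<gamma> A z) UNIV)"

text \<open>The first conjunct (the SGDM recursion) is a consequence of the second one (the convolution
  formula); it is kept so that \<open>x\<close> is visibly a sequence of SGDM iterates.\<close>

definition stationary_sgdm ::
  "nat \<Rightarrow> (nat \<Rightarrow> real^'d^'d) \<Rightarrow> (nat \<Rightarrow> real^'d) \<Rightarrow> real \<Rightarrow> real \<Rightarrow>
   'w measure \<Rightarrow> (int \<Rightarrow> 'w \<Rightarrow> nat) \<Rightarrow> (int \<Rightarrow> 'w \<Rightarrow> real^'d) \<Rightarrow> bool" where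
  "stationary_sgdm n As bs \<alpha> \<gamma> M I x \<longleftrightarrow>
     (\<forall>k. \<forall>\<omega>\<in>space M.
        x (k + 1) \<omega> = x k \<omega> + \<alpha> *\<^sub>R (x k \<omega> - x (k - 1) \<omega>)
                      - \<gamma> *\<^sub>R grad_hat n As bs (I k \<omega>) (x k \<omega>)) \<and>
     (\<exists>H. sgdm_impulse_response \<alpha> \<gamma> (emp_mean n As) H \<and>
        (\<forall>k. \<forall>\<omega>\<in>space M.
           ((\<lambda>j. H (k - j) *v y_noise n As bs (I j \<omega>)) has_sum (x k \<omega> - x_star n As bs)) UNIV))"

definition sampled_with_replacement :: "nat \<Rightarrow> 'w measure \<Rightarrow> (int \<Rightarrow> 'w \<Rightarrow> nat) \<Rightarrow> bool" where
  "sampled_with_replacement n M I \<longleftrightarrow>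
     prob_space.indep_vars M (\<lambda>_. count_space {1..n}) I UNIV \<and>
     (\<forall>k. distr M (count_space {1..n}) (I k) = uniform_count_measure {1..n})"

definition Var_mat :: "'w measure \<Rightarrow> ('w \<Rightarrow> real^'d) \<Rightarrow> real^'d^'d" where
  "Var_mat M X = (LINT \<omega>|M. outer (X \<omega> - (LINT \<omega>'|M. X \<omega>')))"


section \<open>The closed-form coefficients\<close>

definition disc :: "real \<Rightarrow> real \<Rightarrow> real \<Rightarrow> real" where
  "disc \<alpha> \<gamma> l = (1 - \<alpha>)\<^sup>2 + \<gamma>\<^sup>2 * l\<^sup>2 - 2 * (1 + \<alpha>) * \<gamma> * l"

definition rho_plus :: "real \<Rightarrow> real \<Rightarrow> real \<Rightarrow> real" where
  "rho_plus \<alpha> \<gamma> l =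
     (2 * (1 - \<alpha>)\<^sup>2 + \<gamma>\<^sup>2 * l\<^sup>2 - 2 * (1 + \<alpha>) * \<gamma> * l
        + 2 * (1 - \<alpha>) * sqrt (disc \<alpha> \<gamma> l)) / (\<gamma>\<^sup>2 * l\<^sup>2)"

definition rho_minus :: "real \<Rightarrow> real \<Rightarrow> real \<Rightarrow> real" where
  "rho_minus \<alpha> \<gamma> l =
     (2 * (1 - \<alpha>)\<^sup>2 + \<gamma>\<^sup>2 * l\<^sup>2 - 2 * (1 + \<alpha>) * \<gamma> * l
        - 2 * (1 - \<alpha>) * sqrt (disc \<alpha> \<gamma> l)) / (\<gamma>\<^sup>2 * l\<^sup>2)"

definition raw_coef :: "real \<Rightarrow> real \<Rightarrow> real \<Rightarrow> real" where
  "raw_coef \<alpha> \<gamma> l =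
     (sqrt (rho_plus \<alpha> \<gamma> l) - sqrt (rho_minus \<alpha> \<gamma> l)
        - 1 / sqrt (rho_plus \<alpha> \<gamma> l) + 1 / sqrt (rho_minus \<alpha> \<gamma> l))
     / (4 * (1 - \<alpha>) * sqrt (disc \<alpha> \<gamma> l))"

text \<open>If \<open>disc \<alpha> \<gamma> l = 0\<close> then \<open>raw_coef\<close> is formally \<open>0 / 0\<close>, which HOL evaluates to \<open>0\<close>. There the
  coefficient is read as the limit along eigenvalues with positive discriminant; this limit exists
  and is unique (lemmas \<open>raw_coef_tendsto\<close> and \<open>var_coef_degenerate\<close> below).\<close>

definition var_coef :: "real \<Rightarrow> real \<Rightarrow> real \<Rightarrow> real" where
  "var_coef \<alpha> \<gamma> l =
     (if disc \<alpha> \<gamma> l = 0 then Lim (at l within {m. disc \<alpha> \<gamma> m > 0}) (raw_coef \<alpha> \<gamma>)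
      else raw_coef \<alpha> \<gamma> l)"

lemma raw_coef_closed_form:
  assumes "\<gamma> > 0" "\<alpha> < 1" "m > 0" "2 * (1 + \<alpha>) - \<gamma> * m > 0" "disc \<alpha> \<gamma> m > 0"
  shows "raw_coef \<alpha> \<gamma> m = (1 + \<alpha>) / ((1 - \<alpha>) * (\<gamma> * m * (2 * (1 + \<alpha>) - \<gamma> * m)))"
proof -
  define a s p q where "a = 1 - \<alpha>" and "s = sqrt (disc \<alpha> \<gamma> m)"
    and "p = \<gamma> * m" and "q = 2 * (1 + \<alpha>) - \<gamma> * m"
  have pos: "a > 0" "s > 0" "p > 0" "q > 0"
    using assms by (auto simp: a_def s_def p_def q_def)
  have s2: "s\<^sup>2 = disc \<alpha> \<gamma> m" using assms by (simp add: s_def)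
  have pq: "(a + s) * (a - s) = p * q"
    using s2 by (simp add: disc_def a_def p_def q_def power2_eq_square algebra_simps)
  have "(a + s) * (a - s) > 0" using pq pos by simp
  then have as: "a - s > 0" using pos by (simp add: zero_less_mult_iff)
  have "2 * (1 - \<alpha>)\<^sup>2 + \<gamma>\<^sup>2 * m\<^sup>2 - 2 * (1 + \<alpha>) * \<gamma> * m + 2 * (1 - \<alpha>) * s = (a + s)\<^sup>2"
    using s2 unfolding disc_def power2_sum a_def by (simp add: algebra_simps)
  then have "rho_plus \<alpha> \<gamma> m = ((a + s) / p)\<^sup>2"
    by (simp add: rho_plus_def s_def[symmetric] p_def power_divide power_mult_distrib)
  then have rp: "sqrt (rho_plus \<alpha> \<gamma> m) = (a + s) / p" using pos by simp
  have "2 * (1 - \<alpha>)\<^sup>2 + \<gamma>\<^sup>2 * m\<^sup>2 - 2 * (1 + \<alpha>) * \<gamma> * m - 2 * (1 - \<alpha>) * s = (a - s)\<^sup>2"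
    using s2 unfolding disc_def power2_diff a_def by (simp add: algebra_simps)
  then have "rho_minus \<alpha> \<gamma> m = ((a - s) / p)\<^sup>2"
    by (simp add: rho_minus_def s_def[symmetric] p_def power_divide power_mult_distrib)
  then have rm: "sqrt (rho_minus \<alpha> \<gamma> m) = (a - s) / p" using pos as by simp
  have i1: "1 / sqrt (rho_plus \<alpha> \<gamma> m) = (a - s) / q"
    unfolding rp using pq pos by (simp add: field_simps)
  have i2: "1 / sqrt (rho_minus \<alpha> \<gamma> m) = (a + s) / q"
    unfolding rm using pq pos as by (simp add: field_simps)
  have "raw_coef \<alpha> \<gamma> m = ((a + s) / p - (a - s) / p - (a - s) / q + (a + s) / q) / (4 * a * s)"
    unfolding raw_coef_def i1 i2 unfolding rp rm a_def s_def by (rule refl)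
  also have "\<dots> = (2 * s * (p + q) / (p * q)) / (4 * a * s)"
    using pos by (simp add: field_simps)
  also have "p + q = 2 * (1 + \<alpha>)" by (simp add: p_def q_def)
  also have "(2 * s * (2 * (1 + \<alpha>)) / (p * q)) / (4 * a * s) = (1 + \<alpha>) / (a * (p * q))"
    using pos by (simp add: field_simps)
  finally show ?thesis by (simp add: a_def p_def q_def)
qed

lemma raw_coef_tendsto:
  assumes "\<gamma> > 0" "0 \<le> \<alpha>" "\<alpha> < 1" "disc \<alpha> \<gamma> l = 0"
  shows "(raw_coef \<alpha> \<gamma> \<longlongrightarrow> (1 + \<alpha>) / ((1 - \<alpha>) * (\<gamma> * l * (2 * (1 + \<alpha>) - \<gamma> * l))))
           (at l within {m. disc \<alpha> \<gamma> m > 0})"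
proof -
  have eq: "(\<gamma> * l) * (2 * (1 + \<alpha>) - \<gamma> * l) = (1 - \<alpha>)\<^sup>2"
    using assms(4) by (simp add: disc_def power2_eq_square algebra_simps)
  then have prod: "(\<gamma> * l) * (2 * (1 + \<alpha>) - \<gamma> * l) > 0" using assms by simp
  then have pos: "\<gamma> * l > 0 \<and> 2 * (1 + \<alpha>) - \<gamma> * l > 0"
    using assms(2) unfolding zero_less_mult_iff[of "\<gamma> * l"] by auto
  then have l: "l > 0" using assms by (simp add: zero_less_mult_iff)
  let ?F = "at l within {m. disc \<alpha> \<gamma> m > 0}"
  let ?g = "\<lambda>m. (1 + \<alpha>) / ((1 - \<alpha>) * (\<gamma> * m * (2 * (1 + \<alpha>) - \<gamma> * m)))"
  have lim: "(?g \<longlongrightarrow> ?g l) ?F"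
    using pos assms l by (intro tendsto_intros) auto
  have "((\<lambda>m. m) \<longlongrightarrow> l) ?F" "((\<lambda>m. 2 * (1 + \<alpha>) - \<gamma> * m) \<longlongrightarrow> 2 * (1 + \<alpha>) - \<gamma> * l) ?F"
    by (intro tendsto_intros)+
  then have "eventually (\<lambda>m. m > 0) ?F" "eventually (\<lambda>m. 2 * (1 + \<alpha>) - \<gamma> * m > 0) ?F"
    using l pos by (blast dest: order_tendstoD(1))+
  moreover have "eventually (\<lambda>m. disc \<alpha> \<gamma> m > 0) ?F"
    by (simp add: eventually_at_filter)
  ultimately have "eventually (\<lambda>m. ?g m = raw_coef \<alpha> \<gamma> m) ?F"
    by eventually_elim (use assms raw_coef_closed_form in auto)
  from Lim_transform_eventually[OF lim this] show ?thesis .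
qed

lemma var_coef_degenerate:
  assumes "\<gamma> > 0" "0 \<le> \<alpha>" "\<alpha> < 1" "disc \<alpha> \<gamma> l = 0"
  shows "var_coef \<alpha> \<gamma> l = (1 + \<alpha>) / ((1 - \<alpha>) * (\<gamma> * l * (2 * (1 + \<alpha>) - \<gamma> * l)))"
proof -
  define c where "c = 2 * \<gamma>\<^sup>2 * l - 2 * (1 + \<alpha>) * \<gamma>"
  define t :: real where "t = (if c \<ge> 0 then 1 else -1)"
  have t: "t * c \<ge> 0" "t\<^sup>2 = 1" "\<bar>t\<bar> = 1" "t \<noteq> 0" by (auto simp: t_def)
  have "disc \<alpha> \<gamma> (l + e * t) > 0" if "e > 0" for e
  proof -
    have "disc \<alpha> \<gamma> (l + e * t) = disc \<alpha> \<gamma> l + e * (t * c) + \<gamma>\<^sup>2 * e\<^sup>2 * t\<^sup>2"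
      by (simp add: disc_def c_def power2_eq_square algebra_simps)
    also have "\<dots> > 0" using t assms that by (simp add: add_nonneg_pos)
    finally show ?thesis .
  qed
  then have "l islimpt {m. disc \<alpha> \<gamma> m > 0}"
    unfolding islimpt_approachable
  proof (intro allI impI)
    fix e :: real assume *: "\<And>e. 0 < e \<Longrightarrow> 0 < disc \<alpha> \<gamma> (l + e * t)" and e: "0 < e"
    then show "\<exists>m\<in>{m. disc \<alpha> \<gamma> m > 0}. m \<noteq> l \<and> dist m l < e"
      using t *[of "e / 2"] by (intro bexI[of _ "l + (e / 2) * t"]) (auto simp: dist_real_def abs_mult)
  qed
  then have nontriv: "at l within {m. disc \<alpha> \<gamma> m > 0} \<noteq> bot"
    by (simp add: trivial_limit_within)
  have "Lim (at l within {m. disc \<alpha> \<gamma> m > 0}) (raw_coef \<alpha> \<gamma>)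
          = (1 + \<alpha>) / ((1 - \<alpha>) * (\<gamma> * l * (2 * (1 + \<alpha>) - \<gamma> * l)))"
    using nontriv raw_coef_tendsto[OF assms] by (rule tendsto_Lim)
  then show ?thesis
    using assms(4) by (simp add: var_coef_def)
qed

end

theory Submission
  imports Defs
begin

text \<open>For a unit eigenvector \<open>u\<close> of \<open>A\<close> with eigenvalue \<open>l\<close>, multiplying the transfer function by the pencil
  and comparing Fourier coefficients shows that \<open>u \<bullet> H k w = h k (u \<bullet> w)\<close> for an absolutely
  summable scalar sequence \<open>h\<close> with
  \<open>h (k + 1) - (1 + \<alpha> - \<gamma> l) h k + \<alpha> h (k - 1) = - \<gamma> \<delta>\<close>. By independence, the variance of
  \<open>x k\<close> in direction \<open>u\<close> is \<open>(u \<bullet> \<Sigma> u) \<Sum> h\<^sup>2\<close>. Multiplying the recursion by shifts of \<open>h\<close>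
  and summing (the Yule-Walker equations) expresses \<open>\<Sum> h\<^sup>2\<close> through \<open>h (-1)\<close>, \<open>h 0\<close>, \<open>h 1\<close>.
  These values depend on the roots of \<open>z\<^sup>2 - (1 + \<alpha> - \<gamma> l) z + \<alpha>\<close>: if
  \<open>\<gamma> l < 2 (1 + \<alpha>)\<close>, both lie inside the unit disc and \<open>h\<close> is causal; if
  \<open>\<gamma> l > 2 (1 + \<alpha>)\<close>, exactly one does and \<open>h\<close> is two-sided. The stated formula holds in both
  regimes, and equality is excluded because the pencil is invertible at \<open>z = -1\<close>.\<close>

section \<open>Uniqueness of Fourier coefficients on the unit circle\<close>

lemma integral_cis_int:
  "integral {0..2*pi} (\<lambda>t. cis (of_int k * t)) = (if k = 0 then of_real (2*pi) else 0)"
proof (cases "k = 0")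
  case False
  have "((\<lambda>t. cis (of_int k * t)) has_integral
      (cis (of_int k * (2*pi)) / (\<i> * of_int k) - cis (of_int k * 0) / (\<i> * of_int k))) {0..2*pi}"
    by (rule fundamental_theorem_of_calculus)
       (use False in \<open>auto simp: has_vector_derivative_def scaleR_conv_of_real field_simps intro!: derivative_eq_intros\<close>)
  moreover have "cis (of_int k * (2*pi)) = 1"
    using cis_multiple_2pi[of "of_int k"] by (simp add: mult.commute)
  ultimately have "((\<lambda>t. cis (of_int k * t)) has_integral 0) {0..2*pi}"
    by simp
  then show ?thesis using False by (simp add: integral_unique)
qed (simp add: scaleR_conv_of_real)

text \<open>Symmetric windows are cofinal among the finite sets of integers, so an unordered sum can
  be computed along a sequence, as dominated convergence requires.\<close>

lemma has_sum_int_imp_LIMSEQ: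
  fixes f :: "int \<Rightarrow> 'a::topological_comm_monoid_add"
  assumes "(f has_sum s) UNIV"
  shows "(\<lambda>N. \<Sum>k = - int N..int N. f k) \<longlonglongrightarrow> s"
proof -
  have "filterlim (\<lambda>N. {- int N..int N}) (finite_subsets_at_top UNIV) sequentially"
    unfolding filterlim_finite_subsets_at_top
  proof (intro allI impI)
    fix X :: "int set" assume X: "finite X \<and> X \<subseteq> UNIV"
    define K where "K = nat (\<Sum>x\<in>X. \<bar>x\<bar>)"
    have le: "\<bar>x\<bar> \<le> int K" if "x \<in> X" for x
      using X that member_le_sum[of x X abs] by (auto simp: K_def sum_nonneg)
    show "\<forall>\<^sub>F N in sequentially. finite {- int N..int N} \<and> X \<subseteq> {- int N..int N} \<and> {- int N..int N} \<subseteq> UNIV"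
      using eventually_ge_at_top[of K] by eventually_elim (use le in force)
  qed
  then show ?thesis
    using assms unfolding has_sum_def by (rule filterlim_compose[rotated])
qed

text \<open>Multiplying by \<open>z powi k\<close> and integrating over the circle isolates
  \<open>c k\<close> by orthogonality, while dominated convergence sends the integrals of the
  partial sums to \<open>0\<close>.\<close>

lemma fourier_coefficients_zero:
  fixes c :: "int \<Rightarrow> complex"
  assumes "\<And>z. cmod z = 1 \<Longrightarrow> ((\<lambda>k. z powi (- k) * c k) has_sum 0) UNIV"
  shows "c k = 0"
proof -
  \<comment> \<open>At \<open>z = 1\<close> the hypothesis makes \<open>c\<close> itself summable,
    hence absolutely summable; this yields the dominating constant \<open>B\<close>.\<close>
  have "(c has_sum 0) UNIV" using assms[of 1] by simp
  then have "c summable_on UNIV" by (rule has_sum_imp_summable)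
  then have abs: "(\<lambda>k. cmod (c k)) summable_on UNIV"
    by (simp add: summable_on_iff_abs_summable_on_complex)
  define B where "B = (\<Sum>\<^sub>\<infinity>k. cmod (c k))"
  define f where "f = (\<lambda>N t. \<Sum>j = - int N..int N. cis (of_int (k - j) * t) * c j)"
  have f_int: "integral {0..2*pi} (f N) = (if k \<in> {- int N..int N} then of_real (2*pi) * c k else 0)" for N
  proof -
    have "integral {0..2*pi} (f N)
        = (\<Sum>j = - int N..int N. integral {0..2*pi} (\<lambda>t. cis (of_int (k - j) * t) * c j))"
      unfolding f_def
      by (rule integral_sum) (auto intro!: integrable_continuous_real continuous_intros)
    also have "\<dots> = (\<Sum>j = - int N..int N. (if j = k then of_real (2*pi) * c k else 0))"
      by (intro sum.cong refl) (use integral_cis_int[of "k - _"] in auto)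
    also have "\<dots> = (if k \<in> {- int N..int N} then of_real (2*pi) * c k else 0)"
      by (simp add: sum.delta)
    finally show ?thesis .
  qed
  have "(\<lambda>N. integral {0..2*pi} (f N)) \<longlonglongrightarrow> integral {0..2*pi} (\<lambda>t. 0::complex)"
  proof (rule dominated_convergence(2)[where h = "\<lambda>_. B"])
    show "f N integrable_on {0..2*pi}" for N
      unfolding f_def by (auto intro!: integrable_continuous_real continuous_intros)
    show "norm (f N t) \<le> B" for N t
    proof -
      have "norm (f N t) \<le> (\<Sum>j = - int N..int N. cmod (c j))"
        unfolding f_def by (rule order_trans[OF norm_sum]) (simp add: norm_mult)
      also have "\<dots> \<le> B" unfolding B_def
        by (rule finite_sum_le_infsum[OF abs]) auto
      finally show ?thesis .
    qed
    show "(\<lambda>N. f N t) \<longlonglongrightarrow> 0" for t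
    proof -
      have "(\<lambda>N. cis (of_int k * t) * (\<Sum>j = - int N..int N. cis t powi (- j) * c j)) \<longlonglongrightarrow> cis (of_int k * t) * 0"
        by (intro tendsto_mult_left has_sum_int_imp_LIMSEQ assms) auto
      moreover have "cis (of_int k * t) * (\<Sum>j = - int N..int N. cis t powi (- j) * c j) = f N t" for N
        unfolding f_def sum_distrib_left
        by (intro sum.cong refl) (simp add: cis_power_int cis_mult algebra_simps flip: mult.assoc)
      ultimately show ?thesis by simp
    qed
  qed auto
  moreover have "\<forall>\<^sub>F N in sequentially. integral {0..2*pi} (f N) = of_real (2*pi) * c k"
    using eventually_ge_at_top[of "nat \<bar>k\<bar>"] by eventually_elim (auto simp: f_int)
  then have "(\<lambda>N. integral {0..2*pi} (f N)) \<longlonglongrightarrow> of_real (2*pi) * c k"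
    by (rule tendsto_eventually)
  ultimately have "of_real (2*pi) * c k = integral {0..2*pi} (\<lambda>t. 0::complex)"
    by (intro LIMSEQ_unique[where X = "\<lambda>N. integral {0..2*pi} (f N)"])
  then show ?thesis by simp
qed

lemma fourier_coefficients_unique:
  fixes c d :: "int \<Rightarrow> complex"
  assumes "\<And>z. cmod z = 1 \<Longrightarrow> ((\<lambda>k. z powi (- k) * c k) has_sum s z) UNIV"
    and "\<And>z. cmod z = 1 \<Longrightarrow> ((\<lambda>k. z powi (- k) * d k) has_sum s z) UNIV"
  shows "c = d"
proof
  fix k
  have "((\<lambda>k. z powi (- k) * (c k - d k)) has_sum 0) UNIV" if "cmod z = 1" for z
    using has_sum_add[OF assms(1)[OF that] has_sum_uminusI[OF assms(2)[OF that]]] by (simp add: algebra_simps)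
  then have "c k - d k = 0" by (rule fourier_coefficients_zero)
  then show "c k = d k" by simp
qed

section \<open>The scalar momentum recursion\<close>

text \<open>Unrolling gives \<open>g k = r ^ j * g (k - int j)\<close>, and boundedness of
  \<open>g\<close> leaves a factor tending to zero. This excludes homogeneous solutions that blow up
  in the past.\<close>

lemma bounded_backward_geometric_zero:
  fixes g :: "int \<Rightarrow> real"
  assumes rec: "\<And>k. k \<le> m \<Longrightarrow> g k = r * g (k - 1)"
    and r: "\<bar>r\<bar> < 1" and B: "\<And>k. \<bar>g k\<bar> \<le> B" and k: "k \<le> m"
  shows "g k = 0"
proof -
  have it: "g k = r ^ j * g (k - int j)" for j
  proof (induction j)
    case (Suc j)
    then show ?case using rec[of "k - int j"] k by (simp add: algebra_simps)
  qed simp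
  have "\<bar>g k\<bar> \<le> \<bar>r\<bar> ^ j * B" for j
  proof -
    have "\<bar>g k\<bar> = \<bar>r\<bar> ^ j * \<bar>g (k - int j)\<bar>" by (subst it[of j]) (simp add: abs_mult power_abs)
    also have "\<dots> \<le> \<bar>r\<bar> ^ j * B" by (intro mult_left_mono B) auto
    finally show ?thesis .
  qed
  moreover have "(\<lambda>j. \<bar>r\<bar> ^ j * B) \<longlonglongrightarrow> 0"
    using r by (auto intro!: tendsto_mult_left_zero LIMSEQ_power_zero)
  ultimately have "\<bar>g k\<bar> \<le> 0"
    by (intro LIMSEQ_le_const[where X = "\<lambda>j. \<bar>r\<bar> ^ j * B"]) auto
  then show ?thesis by simp
qed

text \<open>Time reversal turns this into the backward case with ratio \<open>1 / r\<close>; it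
  excludes solutions that blow up in the future.\<close>

lemma bounded_forward_geometric_zero:
  fixes g :: "int \<Rightarrow> real"
  assumes rec: "\<And>k. k \<ge> m \<Longrightarrow> g (k + 1) = r * g k"
    and r: "\<bar>r\<bar> > 1" and B: "\<And>k. \<bar>g k\<bar> \<le> B" and k: "k \<ge> m"
  shows "g k = 0"
proof -
  have "g (- j) = (1 / r) * g (- (j - 1))" if "j \<le> - m" for j
    using rec[of "- j"] r that by (auto simp: algebra_simps)
  then have "g (- (- k)) = 0"
    using r B k by (intro bounded_backward_geometric_zero[where g = "\<lambda>j. g (- j)" and m = "- m" and r = "1 / r"]) auto
  then show ?thesis by simp
qed

lemma has_sum_int_shift:
  fixes f :: "int \<Rightarrow> 'a::topological_comm_monoid_add"
  shows "((\<lambda>k. f (k + m)) has_sum s) UNIV \<longleftrightarrow> (f has_sum s) UNIV"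
  by (rule has_sum_reindex_bij_betw) (rule bij_plus_right)

text \<open>For \<open>q < 0\<close> one has \<open>s > a\<close>, so the square root of
  \<open>rho_minus\<close> is \<open>(s - a) / p\<close> instead of \<open>(a - s) / p\<close>. This
  sign change is why the value differs from \<open>raw_coef_closed_form\<close>.\<close>

lemma raw_coef_closed_form_unstable:
  assumes "\<gamma> > 0" "0 \<le> \<alpha>" "\<alpha> < 1" "m > 0" "2 * (1 + \<alpha>) - \<gamma> * m < 0"
  shows "raw_coef \<alpha> \<gamma> m
    = (1 + \<alpha> - \<gamma> * m) / (sqrt (disc \<alpha> \<gamma> m) * (\<gamma> * m * (2 * (1 + \<alpha>) - \<gamma> * m)))"
proof -
  define a s p q where "a = 1 - \<alpha>" and "s = sqrt (disc \<alpha> \<gamma> m)"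
    and "p = \<gamma> * m" and "q = 2 * (1 + \<alpha>) - \<gamma> * m"
  have pos: "a > 0" "p > 0" "q < 0"
    using assms by (auto simp: a_def p_def q_def)
  have d: "disc \<alpha> \<gamma> m = a\<^sup>2 - p * q"
    by (simp add: disc_def a_def p_def q_def power2_eq_square algebra_simps)
  have "p * q < 0" using pos by (simp add: mult_pos_neg)
  have s2: "s\<^sup>2 = a\<^sup>2 - p * q"
    using d \<open>p * q < 0\<close> zero_le_power2[of a] unfolding s_def by (subst real_sqrt_pow2) linarith+
  then have "a\<^sup>2 < s\<^sup>2" using \<open>p * q < 0\<close> by simp
  have "0 \<le> s" using d \<open>p * q < 0\<close> zero_le_power2[of a] unfolding s_def by (intro real_sqrt_ge_zero) linarith
  with \<open>a\<^sup>2 < s\<^sup>2\<close> have as: "a < s" by (rule power2_less_imp_less)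
  \<comment> \<open>This factorisation turns the reciprocals of the two square roots into fractions
    over \<open>q\<close>.\<close>
  have pq: "(a + s) * (a - s) = p * q"
    using s2 by (simp add: power2_eq_square algebra_simps)
  have num: "2 * (1 - \<alpha>)\<^sup>2 + \<gamma>\<^sup>2 * m\<^sup>2 - 2 * (1 + \<alpha>) * \<gamma> * m = a\<^sup>2 + s\<^sup>2"
    unfolding s2 by (simp add: a_def p_def q_def power2_eq_square algebra_simps)
  have "rho_plus \<alpha> \<gamma> m = ((a + s) / p)\<^sup>2"
    unfolding rho_plus_def num by (simp add: s_def[symmetric] a_def[symmetric] p_def power_divide power_mult_distrib power2_sum)
  then have rp: "sqrt (rho_plus \<alpha> \<gamma> m) = (a + s) / p" using pos as by simp
  have "rho_minus \<alpha> \<gamma> m = ((s - a) / p)\<^sup>2"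
    unfolding rho_minus_def num by (simp add: s_def[symmetric] a_def[symmetric] p_def power_divide power_mult_distrib power2_diff algebra_simps)
  then have rm: "sqrt (rho_minus \<alpha> \<gamma> m) = (s - a) / p" using pos as by simp
  have i1: "1 / sqrt (rho_plus \<alpha> \<gamma> m) = (a - s) / q"
    unfolding rp using pq pos as by (simp add: field_simps)
  have i2: "1 / sqrt (rho_minus \<alpha> \<gamma> m) = - (a + s) / q"
    unfolding rm using pq pos as by (simp add: field_simps)
  have "raw_coef \<alpha> \<gamma> m = ((a + s) / p - (s - a) / p - (a - s) / q + - (a + s) / q) / (4 * a * s)"
    unfolding raw_coef_def i1 i2 unfolding rp rm a_def s_def by (rule refl)
  also have "(a + s) / p - (s - a) / p - (a - s) / q + - (a + s) / q = 2 * a * (q - p) / (p * q)"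
    using pos by (simp add: field_simps)
  also have "q - p = 2 * (1 + \<alpha> - p)" by (simp add: p_def q_def)
  also have "(2 * a * (2 * (1 + \<alpha> - p)) / (p * q)) / (4 * a * s) = (1 + \<alpha> - p) / (s * (p * q))"
    using pos as by (simp add: field_simps)
  finally show ?thesis by (simp add: s_def p_def q_def)
qed

text \<open>With the autocorrelation \<open>c m = \<Sum>\<^sub>k h k h (k + m)\<close>, the recursion multiplied by \<open>h (k + m)\<close>
  gives \<open>c (m - 1) - T c m + \<alpha> c (m + 1) = - \<gamma> h m\<close>; for \<open>m \<in> {-1, 0, 1}\<close> this determines
  \<open>c 0\<close>, since \<open>c\<close> is even.\<close>

lemma momentum_autocorrelation:
  fixes h :: "int \<Rightarrow> real"
  assumes rec: "\<And>k. h (k + 1) - T * h k + \<alpha> * h (k - 1) = (if k = 0 then - \<gamma> else 0)"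
    and abs: "(\<lambda>k. \<bar>h k\<bar>) summable_on UNIV"
  shows "(1 - \<alpha>) * ((1 + \<alpha>)\<^sup>2 - T\<^sup>2) * (\<Sum>\<^sub>\<infinity>k. (h k)\<^sup>2)
    = - \<gamma> * ((1 + \<alpha>) * (h 1 - \<alpha> * h (-1)) + (1 - \<alpha>) * T * h 0)"
proof -
  have bound: "\<bar>h k\<bar> \<le> (\<Sum>\<^sub>\<infinity>k. \<bar>h k\<bar>)" for k
    using finite_sum_le_infsum[OF abs, of "{k}"] by simp
  \<comment> \<open>One factor is bounded by the sum of all \<open>\<bar>h k\<bar>\<close>, the
    other is absolutely summable.\<close>
  have summ: "(\<lambda>k. h k * h (k + m)) summable_on UNIV" for m
  proof -
    have "(\<lambda>k. (\<Sum>\<^sub>\<infinity>k. \<bar>h k\<bar>) * norm (h k)) summable_on UNIV"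
      using abs by (intro summable_on_cmult_right) simp
    then have "(\<lambda>k. norm (h k * h (k + m))) summable_on UNIV"
      by (rule summable_on_comparison_test)
         (auto simp: abs_mult mult.commute intro!: mult_left_mono bound)
    then show ?thesis by (rule abs_summable_summable)
  qed
  define c where "c m = (\<Sum>\<^sub>\<infinity>k. h k * h (k + m))" for m
  have c: "((\<lambda>k. h k * h (k + m)) has_sum c m) UNIV" for m
    unfolding c_def using summ by (rule has_sum_infsum)
  have c_shift: "((\<lambda>k. h (k + j) * h (k + m)) has_sum c (m - j)) UNIV" for j m
    using c[of "m - j"] has_sum_int_shift[of "\<lambda>k. h k * h (k + (m - j))" j] by simp
  have c_minus: "c (- m) = c m" for m
    using has_sum_unique[OF c[of "- m"]] c_shift[of "- m" 0] by (simp add: mult.commute)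
  have yw: "c (m - 1) - T * c m + \<alpha> * c (m + 1) = - \<gamma> * h m" for m
  proof -
    have "((\<lambda>k. h (k + 1) * h (k + m) + (- T) * (h (k + 0) * h (k + m)) + \<alpha> * (h (k + (-1)) * h (k + m)))
        has_sum (c (m - 1) + (- T) * c (m - 0) + \<alpha> * c (m - (-1)))) UNIV"
      by (intro has_sum_add has_sum_cmult_right c_shift)
    also have "(\<lambda>k. h (k + 1) * h (k + m) + (- T) * (h (k + 0) * h (k + m)) + \<alpha> * (h (k + (-1)) * h (k + m)))
        = (\<lambda>k. (if k = 0 then - \<gamma> else 0) * h (k + m))"
      by (subst rec[symmetric]) (simp add: algebra_simps)
    finally have "((\<lambda>k. (if k = 0 then - \<gamma> else 0) * h (k + m)) has_sum (c (m - 1) - T * c m + \<alpha> * c (m + 1))) UNIV"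
      by simp
    moreover have "((\<lambda>k. (if k = 0 then - \<gamma> else 0) * h (k + m)) has_sum (- \<gamma> * h m)) UNIV"
      by (rule has_sum_finite_neutralI[of "{0}"]) auto
    ultimately show ?thesis by (rule has_sum_unique)
  qed
  have 1: "(1 + \<alpha>) * c 1 = T * c 0 - \<gamma> * h 0" using yw[of 0] c_minus[of 1] by (simp add: algebra_simps)
  have 2: "c 0 - T * c 1 + \<alpha> * c 2 = - \<gamma> * h 1" using yw[of 1] by simp
  have 3: "c 2 - T * c 1 + \<alpha> * c 0 = - \<gamma> * h (- 1)" using yw[of "-1"] c_minus[of 1] c_minus[of 2] by simp
  \<comment> \<open>Subtracting \<open>\<alpha>\<close> times \<open>3\<close> from \<open>2\<close>
    eliminates \<open>c 2\<close>; afterwards \<open>1\<close> eliminates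
    \<open>c 1\<close>.\<close>
  have "(1 - \<alpha>) * ((1 + \<alpha>) * c 0 - T * c 1) = - \<gamma> * (h 1 - \<alpha> * h (-1))"
    using 2 3 by algebra
  then have "(1 - \<alpha>) * ((1 + \<alpha>)\<^sup>2 - T\<^sup>2) * c 0
    = - \<gamma> * ((1 + \<alpha>) * (h 1 - \<alpha> * h (-1)) + (1 - \<alpha>) * T * h 0)"
    using 1 by algebra
  then show ?thesis by (simp add: c_def power2_eq_square)
qed

text \<open>The autocorrelation identity leaves only \<open>h (-1)\<close>, \<open>h 0\<close> and
  \<open>h 1\<close> to be found. Since \<open>D\<close> makes the characteristic roots real, the
  recursion splits into two first-order ones, whose bounded solutions are determined.\<close>

lemma momentum_energy:
  fixes h :: "int \<Rightarrow> real"
  assumes \<gamma>: "\<gamma> > 0" and \<alpha>: "0 \<le> \<alpha>" "\<alpha> < 1" and l: "l > 0" and D: "disc \<alpha> \<gamma> l \<ge> 0"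
    and ne: "2 * (1 + \<alpha>) - \<gamma> * l \<noteq> 0"
    and rec: "\<And>k. h (k + 1) - (1 + \<alpha> - \<gamma> * l) * h k + \<alpha> * h (k - 1) = (if k = 0 then - \<gamma> else 0)"
    and abs: "(\<lambda>k. \<bar>h k\<bar>) summable_on UNIV"
  shows "(\<Sum>\<^sub>\<infinity>k. (h k)\<^sup>2) = \<gamma>\<^sup>2 * var_coef \<alpha> \<gamma> l"
proof -
  define T s p q where "T = 1 + \<alpha> - \<gamma> * l" and "s = sqrt (disc \<alpha> \<gamma> l)"
    and "p = \<gamma> * l" and "q = 2 * (1 + \<alpha>) - \<gamma> * l"
  define r1 r2 where "r1 = (T + s) / 2" and "r2 = (T - s) / 2"
  have p: "p > 0" using \<gamma> l by (simp add: p_def)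
  have s: "s \<ge> 0" "s\<^sup>2 = T\<^sup>2 - 4 * \<alpha>"
    using D by (simp_all add: s_def T_def) (simp add: disc_def power2_eq_square algebra_simps)
  have sum: "r1 + r2 = T" and diff: "r1 - r2 = s" by (simp_all add: r1_def r2_def field_simps)
  have prod: "r1 * r2 = \<alpha>"
    using s(2) by (simp add: r1_def r2_def power2_eq_square field_simps)
  \<comment> \<open>\<open>p\<close> and \<open>q\<close> are the values of the characteristic
    polynomial at \<open>1\<close> and \<open>-1\<close>; the sign of \<open>q\<close> tells whether
    \<open>-1\<close> separates the roots.\<close>
  have p_eq: "(1 - r1) * (1 - r2) = p" using sum prod by (simp add: T_def p_def algebra_simps)
  have q_eq: "(1 + r1) * (1 + r2) = q" using sum prod by (simp add: T_def q_def algebra_simps)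
  have pq: "(1 + \<alpha>)\<^sup>2 - T\<^sup>2 = p * q" by (simp add: T_def p_def q_def power2_eq_square algebra_simps)
  define E where "E = (\<Sum>\<^sub>\<infinity>k. (h k)\<^sup>2)"
  have energy: "(1 - \<alpha>) * (p * q) * E
      = - \<gamma> * ((1 + \<alpha>) * (h 1 - \<alpha> * h (-1)) + (1 - \<alpha>) * T * h 0)"
    unfolding E_def pq[symmetric] using rec[folded T_def] abs by (rule momentum_autocorrelation)
  have bound: "\<bar>h k\<bar> \<le> (\<Sum>\<^sub>\<infinity>k. \<bar>h k\<bar>)" for k
    using finite_sum_le_infsum[OF abs, of "{k}"] by simp
  define B where "B = (\<Sum>\<^sub>\<infinity>k. \<bar>h k\<bar>)"
  have boundr: "\<bar>h (k + 1) - r * h k\<bar> \<le> B + \<bar>r\<bar> * B" for k r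
  proof -
    have "\<bar>h (k + 1) - r * h k\<bar> \<le> \<bar>h (k + 1)\<bar> + \<bar>r\<bar> * \<bar>h k\<bar>"
      using abs_triangle_ineq4[of "h (k + 1)" "r * h k"] by (simp add: abs_mult)
    also have "\<dots> \<le> B + \<bar>r\<bar> * B"
      unfolding B_def by (intro add_mono mult_left_mono bound) auto
    finally show ?thesis .
  qed
  \<comment> \<open>Each of \<open>f\<close> and \<open>g\<close> divides out one root:
    \<open>f\<close> obeys a first-order recursion with ratio \<open>r2\<close>, \<open>g\<close>
    one with ratio \<open>r1\<close>, both driven by the impulse at \<open>0\<close>.\<close>
  define f g where "f k = h (k + 1) - r1 * h k" and "g k = h (k + 1) - r2 * h k" for k
  have "f k - r2 * f (k - 1) = h (k + 1) - (r1 + r2) * h k + (r1 * r2) * h (k - 1)"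
    and "g k - r1 * g (k - 1) = h (k + 1) - (r1 + r2) * h k + (r1 * r2) * h (k - 1)" for k
    unfolding f_def g_def by (simp_all add: algebra_simps)
  then have f: "f k - r2 * f (k - 1) = (if k = 0 then - \<gamma> else 0)"
    and g: "g k - r1 * g (k - 1) = (if k = 0 then - \<gamma> else 0)" for k
    unfolding sum prod by (simp_all add: rec[folded T_def])
  show ?thesis
  proof (cases "q > 0")
    case True
    then have "p * q > 0" using p by simp
    have "T\<^sup>2 < (1 + \<alpha>)\<^sup>2" using pq \<open>p * q > 0\<close> by simp
    have lt1: "\<bar>r\<bar> < 1" if "r = r1 \<or> r = r2" for r
    proof -
      have "\<bar>T\<bar> < 1 + \<alpha>" using \<open>T\<^sup>2 < (1 + \<alpha>)\<^sup>2\<close> \<alpha>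
        by (intro power2_less_imp_less[of "\<bar>T\<bar>"]) auto
      then have T2: "\<bar>T\<bar> < 2" using \<alpha> by simp
      \<comment> \<open>The difference of the two sides is
        \<open>4 * (1 + \<alpha> - \<bar>T\<bar>)\<close>.\<close>
      have "s\<^sup>2 < (2 - \<bar>T\<bar>)\<^sup>2"
        using \<open>\<bar>T\<bar> < 1 + \<alpha>\<close> unfolding s(2) by (simp add: power2_eq_square algebra_simps)
      then have "s < 2 - \<bar>T\<bar>" using T2 by (intro power2_less_imp_less[of s]) linarith+
      then have "\<bar>r1\<bar> < 1 \<and> \<bar>r2\<bar> < 1"
        using s(1) abs_ge_self[of T] abs_ge_minus_self[of T]
        unfolding r1_def r2_def abs_less_iff by (intro conjI; simp)
      then show ?thesis using that by blast
    qed
    \<comment> \<open>Causality comes in two stages: \<open>g\<close> vanishes before the impulse,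
      and then \<open>h\<close> obeys a first-order recursion with ratio \<open>r2\<close> up to and
      including index \<open>0\<close>.\<close>
    have g0: "g k = 0" if "k \<le> - 1" for k
    proof (rule bounded_backward_geometric_zero[of "-1" g r1])
      show "g k = r1 * g (k - 1)" if "k \<le> - 1" for k
        using g[of k] that by simp
    qed (use lt1[of r1] that boundr[of _ r2, folded g_def] in auto)
    have h0: "h k = 0" if "k \<le> 0" for k
    proof (rule bounded_backward_geometric_zero[of 0 h r2])
      show "h k = r2 * h (k - 1)" if "k \<le> 0" for k
        using g0[of "k - 1"] that by (simp add: g_def)
    qed (use lt1[of r2] bound that in auto)
    have h1: "h 1 = - \<gamma>" using rec[of 0] h0[of 0] h0[of "-1"] by simp
    define K where "K = (1 - \<alpha>) * (p * q)"
    have "K * E = \<gamma>\<^sup>2 * (1 + \<alpha>)"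
      using energy h1 h0 by (simp add: K_def power2_eq_square)
    moreover have "K > 0" using \<alpha> \<open>p * q > 0\<close> by (simp add: K_def)
    ultimately have "E = \<gamma>\<^sup>2 * ((1 + \<alpha>) / K)"
      by (simp add: field_simps)
    \<comment> \<open>For a double root the coefficient is defined as a limit, which has the same
      closed form.\<close>
    moreover have "var_coef \<alpha> \<gamma> l = (1 + \<alpha>) / K"
    proof (cases "disc \<alpha> \<gamma> l = 0")
      case True
      then show ?thesis using var_coef_degenerate \<gamma> \<alpha> by (simp add: K_def p_def q_def)
    next
      case False
      then show ?thesis using raw_coef_closed_form[of \<gamma> \<alpha> l] \<gamma> \<alpha> l D \<open>q > 0\<close>
        by (simp add: K_def p_def q_def var_coef_def)
    qed
    ultimately show ?thesis by (simp add: E_def)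
  next
    case False
    then have q: "q < 0" using ne by (simp add: q_def)
    have "r2 \<le> r1" using diff s by simp
    \<comment> \<open>A negative \<open>q\<close> puts \<open>-1\<close> strictly between the roots,
      and \<open>prod\<close> with \<open>\<alpha> \<ge> 0\<close> keeps \<open>r1\<close> from
      being positive; so exactly one root lies inside the unit disc.\<close>
    have "1 + r2 < 0" "0 < 1 + r1"
      using q_eq q \<open>r2 \<le> r1\<close> by (auto simp: mult_less_0_iff)
    moreover have "r1 \<le> 0" using prod \<alpha> \<open>1 + r2 < 0\<close>
      using mult_pos_neg[of r1 r2] by (cases "r1 > 0") auto
    ultimately have r: "\<bar>r1\<bar> < 1" "\<bar>r2\<bar> > 1" "r2 \<noteq> 0" by auto
    have "s > 0" using diff r \<open>1 + r2 < 0\<close> \<open>0 < 1 + r1\<close> by linarith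
    \<comment> \<open>The response is now two-sided: \<open>g0\<close> makes \<open>h\<close> a pure
      \<open>r2\<close> mode up to index \<open>0\<close>, and \<open>f0\<close> below makes it a
      pure \<open>r1\<close> mode from there on.\<close>
    have g0: "g k = 0" if "k \<le> - 1" for k
    proof (rule bounded_backward_geometric_zero[of "-1" g r1])
      show "g k = r1 * g (k - 1)" if "k \<le> - 1" for k
        using g[of k] that by simp
    qed (use r that boundr[of _ r2, folded g_def] in auto)
    have f0: "f k = 0" if "k \<ge> 0" for k
    proof (rule bounded_forward_geometric_zero[of 0 f r2])
      show "f (k + 1) = r2 * f k" if "k \<ge> 0" for k
        using f[of "k + 1"] that by (simp split: if_splits)
    qed (use r that boundr[of _ r1, folded f_def] in auto)
    have "g 0 = - \<gamma>" using g[of 0] g0[of "-1"] by simp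
    then have h1: "h 1 = r2 * h 0 - \<gamma>" "h 1 = r1 * h 0" "h 0 = r2 * h (-1)"
      using g0[of "-1"] f0[of 0] by (auto simp: f_def g_def)
    have "s * h 0 = - \<gamma>" using h1 unfolding diff[symmetric] by algebra
    \<comment> \<open>This kills the term with factor \<open>1 + \<alpha>\<close> in
      \<open>energy\<close>, so that \<open>1 - \<alpha>\<close> cancels from both sides.\<close>
    have "h 1 - \<alpha> * h (-1) = 0" using h1 prod by algebra
    then have "(1 - \<alpha>) * ((p * q) * E) = (1 - \<alpha>) * (- \<gamma> * (T * h 0))"
      using energy by (simp add: mult_ac)
    then have "(p * q) * E = - \<gamma> * (T * h 0)" using \<alpha> by (subst (asm) mult_left_cancel) auto
    then have "s * ((p * q) * E) = - \<gamma> * T * (s * h 0)" by simp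
    also have "\<dots> = \<gamma>\<^sup>2 * T" unfolding \<open>s * h 0 = - \<gamma>\<close> by (simp add: power2_eq_square)
    finally have "E = \<gamma>\<^sup>2 * (T / (s * (p * q)))"
      using \<open>s > 0\<close> p q by (simp add: field_simps)
    moreover have "var_coef \<alpha> \<gamma> l = T / (s * (p * q))"
      using raw_coef_closed_form_unstable[of \<gamma> \<alpha> l] \<gamma> \<alpha> l q \<open>s > 0\<close>
      by (auto simp: var_coef_def s_def T_def p_def q_def)
    ultimately show ?thesis by (simp add: E_def)
  qed
qed

section \<open>The impulse response along an eigenvector\<close>

lemma invertible_matrix_inv_right:
  fixes N :: "'a::semiring_1^'n^'m"
  assumes "invertible N"
  shows "N ** matrix_inv N = mat 1"
  using someI_ex[OF assms[unfolded invertible_def]] by (simp add: matrix_inv_def)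

lemma mat_matrix_mult_nth:
  fixes N :: "'a::comm_semiring_1^'n^'n"
  shows "(mat c ** N) $ r $ s = c * N $ r $ s"
proof -
  have "(mat c ** N) $ r $ s = (\<Sum>k\<in>UNIV. if k = r then c * N $ k $ s else 0)"
    unfolding matrix_matrix_mult_def mat_def vec_lambda_beta by (rule sum.cong) auto
  then show ?thesis by (simp add: sum.delta)
qed

text \<open>By symmetry \<open>u\<close> is also a left eigenvector of \<open>A\<close>. The
  row-vector form allows multiplication by the inverse of the pencil from the right.\<close>

lemma eigenvector_sgdm_pencil:
  fixes A :: "real^'d^'d" and u :: "real^'d"
  assumes sym: "symmetric_mat A" and eig: "A *v u = l *\<^sub>R u"
  shows "(\<chi> i. of_real (u $ i)) v* sgdm_pencil \<alpha> \<gamma> A z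
    = (z\<^sup>2 - of_real (1 + \<alpha> - \<gamma> * l) * z + of_real \<alpha>) *s (\<chi> i. of_real (u $ i))"
proof -
  have A: "A $ r $ c = A $ c $ r" for r c
    using arg_cong[OF sym[unfolded symmetric_mat_def], of "\<lambda>N. N $ c $ r"] by (simp add: transpose_def)
  have "(\<Sum>r\<in>UNIV. A $ r $ c * u $ r) = l * u $ c" for c
    using arg_cong[OF eig, of "\<lambda>v. v $ c"] by (simp add: matrix_vector_mult_def) (simp add: A[of c])
  then have eig': "(\<Sum>r\<in>UNIV. complex_of_real (A $ r $ c) * of_real (u $ r)) = of_real (l * u $ c)" for c
    by (simp flip: of_real_mult of_real_sum)
  have entry: "sgdm_pencil \<alpha> \<gamma> A z $ r $ c
      = (if r = c then z\<^sup>2 - z * of_real (1 + \<alpha>) + of_real \<alpha> else 0) + z * of_real \<gamma> * of_real (A $ r $ c)" for r c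
    unfolding sgdm_pencil_def vector_add_component vector_minus_component mat_matrix_mult_nth
    by (simp add: mat_def complex_mat_def algebra_simps)
  have "(\<Sum>r\<in>UNIV. sgdm_pencil \<alpha> \<gamma> A z $ r $ c * of_real (u $ r))
      = (\<Sum>r\<in>UNIV. (if r = c then (z\<^sup>2 - z * of_real (1 + \<alpha>) + of_real \<alpha>) * of_real (u $ r) else 0)
          + z * of_real \<gamma> * (of_real (A $ r $ c) * of_real (u $ r)))" for c
    unfolding entry by (intro sum.cong refl) (auto simp: algebra_simps)
  also have "(\<Sum>r\<in>UNIV. (if r = c then (z\<^sup>2 - z * of_real (1 + \<alpha>) + of_real \<alpha>) * of_real (u $ r) else 0)
          + z * of_real \<gamma> * (of_real (A $ r $ c) * of_real (u $ r)))
      = (z\<^sup>2 - of_real (1 + \<alpha> - \<gamma> * l) * z + of_real \<alpha>) * of_real (u $ c)" for c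
    unfolding sum.distrib sum_distrib_left[symmetric] eig' by (simp add: algebra_simps)
  finally show ?thesis
    by (simp add: vec_eq_iff vector_matrix_mult_def algebra_simps)
qed

text \<open>Multiplying \<open>P ** C = mat 1\<close> by the row vector \<open>u\<close> shows that
  \<open>u\<close> is a left eigenvector of \<open>C\<close> with eigenvalue
  \<open>1 / \<chi>z\<close>, so along \<open>u\<close> the transfer function is the scalar
  \<open>- \<gamma> z / \<chi>z\<close>.\<close>

lemma sgdm_impulse_response_mode_has_sum:
  fixes A :: "real^'d^'d" and u w :: "real^'d"
  assumes H: "sgdm_impulse_response \<alpha> \<gamma> A H"
    and sym: "symmetric_mat A" and eig: "A *v u = l *\<^sub>R u" and u: "u \<bullet> u = 1"
    and z: "cmod z = 1"
  defines "\<chi>z \<equiv> z\<^sup>2 - of_real (1 + \<alpha> - \<gamma> * l) * z + of_real \<alpha>"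
  shows "\<chi>z \<noteq> 0"
    and "((\<lambda>k. z powi (- k) * of_real (u \<bullet> (H k *v w))) has_sum (of_real (u \<bullet> w) * (- of_real \<gamma> * z / \<chi>z))) UNIV"
proof -
  define cu :: "complex^'d" where "cu = (\<chi> i. of_real (u $ i))"
  \<comment> \<open>\<open>\<phi> w N\<close> is the bilinear form of \<open>N\<close> at
    \<open>u\<close> and \<open>w\<close>; being bounded linear in \<open>N\<close>, it can be
    applied under the sum over \<open>k\<close>.\<close>
  define \<phi> :: "real^'d \<Rightarrow> complex^'d^'d \<Rightarrow> complex"
    where "\<phi> w N = (\<Sum>c\<in>UNIV. (cu v* N) $ c * of_real (w $ c))" for w N
  define P C where "P = sgdm_pencil \<alpha> \<gamma> A z" and "C = matrix_inv P"
  have "invertible P" using H z by (simp add: sgdm_impulse_response_def P_def)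
  then have PC: "P ** C = mat 1" unfolding C_def by (rule invertible_matrix_inv_right)
  have "\<chi>z *s (cu v* C) = (\<chi>z *s cu) v* C"
    by (simp add: vec_eq_iff vector_matrix_mult_def sum_distrib_left mult_ac)
  also have "\<dots> = (cu v* P) v* C"
    unfolding cu_def P_def \<chi>z_def eigenvector_sgdm_pencil[OF sym eig] ..
  also have "\<dots> = cu" by (simp add: vector_matrix_mul_assoc PC)
  finally have inv: "\<chi>z * (cu v* C) $ c = cu $ c" for c by (simp add: vec_eq_iff)
  have \<phi>_inv: "\<chi>z * \<phi> w C = of_real (u \<bullet> w)" for w
    unfolding \<phi>_def sum_distrib_left mult.assoc[symmetric] inv
    by (simp add: cu_def inner_vec_def)
  \<comment> \<open>For \<open>w = u\<close> the right-hand side of \<open>\<phi>_inv\<close> is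
    \<open>1\<close>.\<close>
  show \<chi>z: "\<chi>z \<noteq> 0" using \<phi>_inv[of u] u by auto
  have \<phi>_mat: "\<phi> w (mat a ** N) = a * \<phi> w N" for a N
    by (simp add: \<phi>_def vector_matrix_mult_def mat_matrix_mult_nth sum_distrib_left sum_distrib_right mult_ac)
  have "linear (\<phi> w)"
    by (rule linearI)
       (simp_all add: \<phi>_def vector_matrix_mult_def sum_distrib_left sum_distrib_right sum.distrib
          scaleR_sum_right algebra_simps)
  then have bl: "bounded_linear (\<phi> w)" by (simp add: linear_conv_bounded_linear)
  have \<phi>_complex_mat: "\<phi> w (complex_mat N) = of_real (u \<bullet> (N *v w))" for N
    unfolding \<phi>_def vector_matrix_mult_def complex_mat_def inner_vec_def matrix_vector_mult_def cu_def
    by (simp add: sum_distrib_left sum_distrib_right) (subst sum.swap, simp add: mult_ac)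
  have "((\<lambda>k. mat (z powi (- k)) ** complex_mat (H k)) has_sum sgdm_transfer \<alpha> \<gamma> A z) UNIV"
    using H z by (simp add: sgdm_impulse_response_def)
  from has_sum_bounded_linear[OF bl this]
  have "((\<lambda>k. z powi (- k) * of_real (u \<bullet> (H k *v w))) has_sum (- of_real \<gamma> * z * \<phi> w C)) UNIV"
    by (simp add: o_def \<phi>_mat \<phi>_complex_mat sgdm_transfer_def C_def P_def)
  moreover have "\<phi> w C = of_real (u \<bullet> w) / \<chi>z"
    using \<phi>_inv[of w] \<chi>z by (simp add: field_simps)
  ultimately show "((\<lambda>k. z powi (- k) * of_real (u \<bullet> (H k *v w))) has_sum (of_real (u \<bullet> w) * (- of_real \<gamma> * z / \<chi>z))) UNIV"
    by (simp add: mult_ac)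
qed

text \<open>Everything is read off from the Fourier series: the first fact at
  \<open>z = - 1\<close>, summability at \<open>z = 1\<close>, the other two from uniqueness of
  coefficients.\<close>

lemma sgdm_impulse_response_mode:
  fixes A :: "real^'d^'d" and u :: "real^'d"
  assumes H: "sgdm_impulse_response \<alpha> \<gamma> A H"
    and sym: "symmetric_mat A" and eig: "A *v u = l *\<^sub>R u" and u: "u \<bullet> u = 1"
  defines "h \<equiv> \<lambda>k. u \<bullet> (H k *v u)"
  shows "2 * (1 + \<alpha>) - \<gamma> * l \<noteq> 0"
    and "(\<lambda>k. \<bar>h k\<bar>) summable_on UNIV"
    and "h (k + 1) - (1 + \<alpha> - \<gamma> * l) * h k + \<alpha> * h (k - 1) = (if k = 0 then - \<gamma> else 0)"
    and "u \<bullet> (H k *v w) = h k * (u \<bullet> w)"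
proof -
  define T where "T = 1 + \<alpha> - \<gamma> * l"
  define X where "X z = z\<^sup>2 - of_real T * z + of_real \<alpha>" for z :: complex
  note mode = sgdm_impulse_response_mode_has_sum[OF H sym eig u, folded T_def, folded X_def]
  have X: "X z \<noteq> 0" if "cmod z = 1" for z using mode(1) that by blast
  have "X (- 1) = of_real (2 * (1 + \<alpha>) - \<gamma> * l)" by (simp add: X_def T_def)
  moreover have "X (- 1) \<noteq> 0" by (rule X) simp
  ultimately show "2 * (1 + \<alpha>) - \<gamma> * l \<noteq> 0" by (metis of_real_0)
  define F where "F z = - of_real \<gamma> * z / X z" for z :: complex
  have hs: "((\<lambda>k. z powi (- k) * of_real (h k)) has_sum F z) UNIV" if "cmod z = 1" for z
    using mode(2)[OF that, of u] u by (simp add: h_def F_def)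
  have "(\<lambda>k. complex_of_real (h k)) summable_on UNIV"
    using hs[of 1] by (auto intro: has_sum_imp_summable)
  then show "(\<lambda>k. \<bar>h k\<bar>) summable_on UNIV"
    by (simp add: summable_on_iff_abs_summable_on_complex)
  \<comment> \<open>Both families have the transform \<open>(u \<bullet> w) F z\<close>, so
    \<open>u\<close> is a left eigenvector of every \<open>H k\<close>.\<close>
  have "(\<lambda>k. complex_of_real (u \<bullet> (H k *v w))) = (\<lambda>k. of_real (u \<bullet> w) * of_real (h k))"
  proof (rule fourier_coefficients_unique)
    fix z :: complex assume z: "cmod z = 1"
    show "((\<lambda>k. z powi (- k) * of_real (u \<bullet> (H k *v w))) has_sum (of_real (u \<bullet> w) * F z)) UNIV"
      unfolding F_def by (rule mode(2)[OF z])
    have "((\<lambda>k. of_real (u \<bullet> w) * (z powi (- k) * of_real (h k))) has_sum (of_real (u \<bullet> w) * F z)) UNIV"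
      by (intro has_sum_cmult_right hs z)
    then show "((\<lambda>k. z powi (- k) * (of_real (u \<bullet> w) * of_real (h k))) has_sum (of_real (u \<bullet> w) * F z)) UNIV"
      by (simp add: mult_ac)
  qed
  from fun_cong[OF this, of k] show "u \<bullet> (H k *v w) = h k * (u \<bullet> w)"
    by (simp only: of_real_eq_iff mult.commute flip: of_real_mult)
  have "(\<lambda>k. complex_of_real (h (k + 1) - T * h k + \<alpha> * h (k - 1))) = (\<lambda>k. of_real (if k = 0 then - \<gamma> else 0))"
  proof (rule fourier_coefficients_unique)
    fix z :: complex assume z: "cmod z = 1"
    then have z0: "z \<noteq> 0" by auto
    \<comment> \<open>An index shift by \<open>m\<close> multiplies the transform by
      \<open>z powi m\<close>. The recursion thus has transform \<open>X z * F z / z\<close>, the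
      constant \<open>- \<gamma>\<close>, which is that of an impulse at \<open>0\<close>.\<close>
    have shift: "((\<lambda>k. z powi (- k) * of_real (h (k + m))) has_sum (z powi m * F z)) UNIV" for m
    proof -
      have "((\<lambda>k. z powi m * (z powi (- (k + m)) * of_real (h (k + m)))) has_sum (z powi m * F z)) UNIV"
        by (intro has_sum_cmult_right) (use hs[OF z] has_sum_int_shift[of "\<lambda>k. z powi (- k) * of_real (h k)" m] in simp)
      moreover have "z powi m * z powi (- (k + m)) = z powi (- k)" for k
        using z0 by (simp flip: power_int_add)
      ultimately show ?thesis by (simp flip: mult.assoc)
    qed
    have "((\<lambda>k. z powi (- k) * of_real (h (k + 1)) + (- of_real T) * (z powi (- k) * of_real (h (k + 0)))
        + of_real \<alpha> * (z powi (- k) * of_real (h (k + (- 1)))))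
        has_sum (z powi 1 * F z + (- of_real T) * (z powi 0 * F z) + of_real \<alpha> * (z powi (- 1) * F z))) UNIV"
      by (intro has_sum_add has_sum_cmult_right shift)
    also have "z powi 1 * F z + (- of_real T) * (z powi 0 * F z) + of_real \<alpha> * (z powi (- 1) * F z) = X z * F z / z"
      using z0 by (simp add: X_def field_simps power2_eq_square)
    also have "\<dots> = - of_real \<gamma>" using z0 X[OF z] by (simp add: F_def)
    finally show "((\<lambda>k. z powi (- k) * of_real (h (k + 1) - T * h k + \<alpha> * h (k - 1))) has_sum (- of_real \<gamma>)) UNIV"
      by (simp add: algebra_simps)
    show "((\<lambda>k. z powi (- k) * of_real (if k = 0 then - \<gamma> else 0)) has_sum (- of_real \<gamma>)) UNIV"
      by (rule has_sum_finite_neutralI[of "{0}"]) auto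
  qed
  from fun_cong[OF this, of k]
  show "h (k + 1) - (1 + \<alpha> - \<gamma> * l) * h k + \<alpha> * h (k - 1) = (if k = 0 then - \<gamma> else 0)"
    unfolding T_def by (simp only: of_real_eq_iff)
qed

section \<open>Variance of the stationary iterates\<close>

text \<open>Summable weights and bounded noise bound all partial sums by one constant, so dominated
  convergence passes both moments to the limit; independence and zero mean remove the off-diagonal
  terms of the second moment.\<close>

lemma (in prob_space) weighted_series_moments:
  fixes W :: "int \<Rightarrow> 'a \<Rightarrow> real"
  assumes indep: "indep_vars (\<lambda>_. borel) W UNIV"
    and W: "\<And>j \<omega>. \<omega> \<in> space M \<Longrightarrow> \<bar>W j \<omega>\<bar> \<le> B"
    and mean: "\<And>j. expectation (W j) = 0"
    and var: "\<And>j. expectation (\<lambda>\<omega>. (W j \<omega>)\<^sup>2) = v"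
    and abs: "(\<lambda>j. \<bar>a j\<bar>) summable_on UNIV"
    and S: "\<And>\<omega>. \<omega> \<in> space M \<Longrightarrow> ((\<lambda>j. a j * W j \<omega>) has_sum S \<omega>) UNIV"
  shows "S \<in> borel_measurable M" "\<exists>C. \<forall>\<omega>\<in>space M. \<bar>S \<omega>\<bar> \<le> C" "expectation S = 0"
    "expectation (\<lambda>\<omega>. (S \<omega>)\<^sup>2) = v * (\<Sum>\<^sub>\<infinity>j. (a j)\<^sup>2)"
proof -
  have meas [measurable]: "W j \<in> borel_measurable M" for j
    using indep by (simp add: indep_vars_def)
  define P where "P N \<omega> = (\<Sum>j = - int N..int N. a j * W j \<omega>)" for N :: nat and \<omega>
  have P_lim: "(\<lambda>N. P N \<omega>) \<longlonglongrightarrow> S \<omega>" if "\<omega> \<in> space M" for \<omega>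
    unfolding P_def using S[OF that] by (rule has_sum_int_imp_LIMSEQ)
  have P_meas [measurable]: "P N \<in> borel_measurable M" for N
    unfolding P_def by measurable
  show S_meas [measurable]: "S \<in> borel_measurable M"
    by (rule borel_measurable_LIMSEQ_real[OF P_lim P_meas])
  define C where "C = (\<Sum>\<^sub>\<infinity>j. \<bar>a j\<bar>) * B"
  \<comment> \<open>A sample point turns the bounds on absolute values into \<open>B \<ge> 0\<close>
    here and \<open>C \<ge> 0\<close> below.\<close>
  obtain \<omega>0 where "\<omega>0 \<in> space M" using not_empty by blast
  then have B: "B \<ge> 0" using W[of \<omega>0 0] by linarith
  have P_bound: "\<bar>P N \<omega>\<bar> \<le> C" if "\<omega> \<in> space M" for N \<omega>
  proof -
    have "\<bar>P N \<omega>\<bar> \<le> (\<Sum>j = - int N..int N. \<bar>a j\<bar> * B)"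
      unfolding P_def using W[OF that]
      by (intro order_trans[OF sum_abs] sum_mono) (auto simp: abs_mult intro!: mult_left_mono)
    also have "\<dots> = (\<Sum>j = - int N..int N. \<bar>a j\<bar>) * B" by (simp add: sum_distrib_right)
    also have "\<dots> \<le> C"
      unfolding C_def using B by (intro mult_right_mono finite_sum_le_infsum[OF abs]) auto
    finally show ?thesis .
  qed
  have S_bound: "\<bar>S \<omega>\<bar> \<le> C" if "\<omega> \<in> space M" for \<omega>
    using tendsto_rabs[OF P_lim[OF that]] P_bound[OF that] by (intro LIMSEQ_le_const2) auto
  then show "\<exists>C. \<forall>\<omega>\<in>space M. \<bar>S \<omega>\<bar> \<le> C" by blast
  have intW: "integrable M (W j)" for j
    using W by (intro integrable_const_bound[of _ B]) (auto intro!: AE_I2)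
  have intWW: "integrable M (\<lambda>\<omega>. W i \<omega> * W j \<omega>)" for i j
    using W by (intro integrable_const_bound[of _ "B * B"]) (auto simp: abs_mult B intro!: AE_I2 mult_mono)
  have cov: "expectation (\<lambda>\<omega>. W i \<omega> * W j \<omega>) = (if i = j then v else 0)" for i j
  proof (cases "i = j")
    case False
    have "expectation (\<lambda>\<omega>. \<Prod>k\<in>{i, j}. W k \<omega>) = (\<Prod>k\<in>{i, j}. expectation (W k))"
      using indep_vars_subset[OF indep] intW by (intro indep_vars_lebesgue_integral) auto
    then show ?thesis using False mean by simp
  qed (use var in \<open>simp add: power2_eq_square\<close>)
  have EP: "expectation (P N) = 0" for N
    unfolding P_def using intW mean by (subst Bochner_Integration.integral_sum) auto
  have EP2: "expectation (\<lambda>\<omega>. (P N \<omega>)\<^sup>2) = (\<Sum>j = - int N..int N. v * (a j)\<^sup>2)" for N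
  proof -
    have "(P N \<omega>)\<^sup>2 = (\<Sum>i = - int N..int N. \<Sum>j = - int N..int N. (a i * a j) * (W i \<omega> * W j \<omega>))" for \<omega>
      unfolding P_def power2_eq_square sum_product by (simp add: mult_ac)
    then have "expectation (\<lambda>\<omega>. (P N \<omega>)\<^sup>2)
        = (\<Sum>i = - int N..int N. \<Sum>j = - int N..int N. (a i * a j) * (if i = j then v else 0))"
      using intWW by (simp add: cov Bochner_Integration.integral_sum)
    then show ?thesis by (simp add: power2_eq_square mult_ac if_distrib cong: if_cong)
  qed
  have "(\<lambda>N. expectation (P N)) \<longlonglongrightarrow> expectation S"
    using P_lim P_bound by (intro integral_dominated_convergence[where w = "\<lambda>_. C"]) (auto intro!: AE_I2)
  then show "expectation S = 0" using EP by (simp add: LIMSEQ_const_iff)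
  have C: "C \<ge> 0" using S_bound[OF \<open>\<omega>0 \<in> space M\<close>] by linarith
  have "(\<lambda>N. expectation (\<lambda>\<omega>. (P N \<omega>)\<^sup>2)) \<longlonglongrightarrow> expectation (\<lambda>\<omega>. (S \<omega>)\<^sup>2)"
  proof (rule integral_dominated_convergence[where w = "\<lambda>_. C\<^sup>2"])
    show "AE \<omega> in M. (\<lambda>N. (P N \<omega>)\<^sup>2) \<longlonglongrightarrow> (S \<omega>)\<^sup>2"
      using P_lim by (auto intro!: AE_I2 tendsto_power)
    show "AE \<omega> in M. norm ((P N \<omega>)\<^sup>2) \<le> C\<^sup>2" for N
      using P_bound C by (auto intro!: AE_I2 simp: abs_le_square_iff[symmetric])
  qed auto
  moreover have "(\<lambda>N. expectation (\<lambda>\<omega>. (P N \<omega>)\<^sup>2)) \<longlonglongrightarrow> v * (\<Sum>\<^sub>\<infinity>j. (a j)\<^sup>2)"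
  proof -
    have bnd: "\<bar>a j\<bar> \<le> (\<Sum>\<^sub>\<infinity>j. \<bar>a j\<bar>)" for j
      using finite_sum_le_infsum[OF abs, of "{j}"] by simp
    have "(\<lambda>j. (a j)\<^sup>2) summable_on UNIV"
    proof (rule summable_on_comparison_test)
      show "(\<lambda>j. (\<Sum>\<^sub>\<infinity>j. \<bar>a j\<bar>) * \<bar>a j\<bar>) summable_on UNIV"
        using abs by (rule summable_on_cmult_right)
      show "(a j)\<^sup>2 \<le> (\<Sum>\<^sub>\<infinity>j. \<bar>a j\<bar>) * \<bar>a j\<bar>" for j
        using mult_right_mono[OF bnd[of j], of "\<bar>a j\<bar>"] by (simp add: power2_eq_square)
    qed auto
    then have "((\<lambda>j. v * (a j)\<^sup>2) has_sum v * (\<Sum>\<^sub>\<infinity>j. (a j)\<^sup>2)) UNIV"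
      by (intro has_sum_cmult_right has_sum_infsum)
    then show ?thesis unfolding EP2 by (rule has_sum_int_imp_LIMSEQ)
  qed
  ultimately show "expectation (\<lambda>\<omega>. (S \<omega>)\<^sup>2) = v * (\<Sum>\<^sub>\<infinity>j. (a j)\<^sup>2)"
    by (rule LIMSEQ_unique)
qed

text \<open>The \<open>u i\<close> are the rows of a square matrix, for which a right inverse is
  also a left inverse; so orthonormality already gives completeness.\<close>

lemma orthonormal_family_expansion:
  fixes u :: "'d \<Rightarrow> real^'d"
  assumes "\<And>i j. u i \<bullet> u j = (if i = j then 1 else 0)"
  shows "(\<Sum>i\<in>UNIV. (u i \<bullet> v) *\<^sub>R u i) = v"
proof -
  define U :: "real^'d^'d" where "U = (\<chi> i. u i)"
  have "U ** transpose U = mat 1"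
    using assms by (simp add: vec_eq_iff U_def matrix_matrix_mult_def transpose_def mat_def inner_vec_def)
  then have "transpose U ** U = mat 1" by (simp add: matrix_left_right_inverse)
  then have "transpose U *v (U *v v) = v" by (simp add: matrix_vector_mul_assoc del: transpose_matrix_vector)
  then show ?thesis
    by (simp add: U_def vec_eq_iff matrix_vector_mult_def vector_matrix_mult_def transpose_def
        inner_vec_def mult.commute)
qed

section \<open>Trace of the variance matrix\<close>

lemma trace_outer: "trace (outer v) = v \<bullet> v"
  by (simp add: trace_def outer_def inner_vec_def)

lemma inner_outer_mult: "u \<bullet> (outer v *v u) = (u \<bullet> v)\<^sup>2"
  by (simp add: outer_def matrix_vector_mult_def inner_vec_def power2_eq_square sum_product mult_ac
      sum_distrib_left)

lemma bounded_linear_trace: "bounded_linear (trace :: real^'d^'d \<Rightarrow> real)"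
  unfolding linear_conv_bounded_linear[symmetric]
  by (rule linearI) (simp_all add: trace_def sum.distrib sum_distrib_left)

text \<open>The trace is the expected squared norm of the centred vector, which splits by Parseval.
  Integrability of the vector and matrix valued functions comes from their bounded
  coordinates.\<close>

lemma (in prob_space) trace_Var_mat_orthonormal:
  fixes X :: "'a \<Rightarrow> real^'d" and u :: "'d \<Rightarrow> real^'d"
  assumes u: "\<And>i j. u i \<bullet> u j = (if i = j then 1 else 0)"
    and meas [measurable]: "\<And>i. (\<lambda>\<omega>. u i \<bullet> (X \<omega> - c)) \<in> borel_measurable M"
    and bound: "\<And>i. \<exists>C. \<forall>\<omega>\<in>space M. \<bar>u i \<bullet> (X \<omega> - c)\<bar> \<le> C"
    and mean: "\<And>i. expectation (\<lambda>\<omega>. u i \<bullet> (X \<omega> - c)) = 0"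
  shows "trace (Var_mat M X) = (\<Sum>i\<in>UNIV. expectation (\<lambda>\<omega>. (u i \<bullet> (X \<omega> - c))\<^sup>2))"
proof -
  define S where "S i \<omega> = u i \<bullet> (X \<omega> - c)" for i \<omega>
  have [measurable]: "S i \<in> borel_measurable M" for i
    unfolding S_def by (rule meas)
  have X: "X \<omega> = c + (\<Sum>i\<in>UNIV. S i \<omega> *\<^sub>R u i)" for \<omega>
    using orthonormal_family_expansion[OF u, of "X \<omega> - c"] by (simp add: S_def)
  obtain C where C: "\<And>i \<omega>. \<omega> \<in> space M \<Longrightarrow> \<bar>S i \<omega>\<bar> \<le> C i"
    using bound unfolding S_def by metis
  have S_int: "integrable M (S i)" for i
    using C by (intro integrable_const_bound[of _ "C i"]) (auto intro!: AE_I2)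
  have SS_int: "integrable M (\<lambda>\<omega>. S i \<omega> * S j \<omega>)" for i j
  proof (rule integrable_const_bound[of _ "C i * C j"])
    show "AE \<omega> in M. norm (S i \<omega> * S j \<omega>) \<le> C i * C j"
    proof (rule AE_I2)
      fix \<omega> assume "\<omega> \<in> space M"
      then show "norm (S i \<omega> * S j \<omega>) \<le> C i * C j"
        using C[of \<omega> i] C[of \<omega> j] by (auto simp: abs_mult intro!: mult_mono)
    qed
  qed simp
  have EX: "(LINT \<omega>|M. X \<omega>) = c"
    unfolding X using S_int mean[folded S_def]
    by (simp add: Bochner_Integration.integral_sum prob_space)
  \<comment> \<open>A finite combination of constant matrices reduces integrability to that of the
    scalar products \<open>S i \<omega> * S j \<omega>\<close>.\<close>
  have outer: "outer (X \<omega> - c) = (\<Sum>i\<in>UNIV. \<Sum>j\<in>UNIV. (S i \<omega> * S j \<omega>) *\<^sub>R (\<chi> r s. u i $ r * u j $ s))" for \<omega>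
    by (simp add: X vec_eq_iff outer_def sum_product mult_ac)
  have "integrable M (\<lambda>\<omega>. outer (X \<omega> - c))"
    unfolding outer using SS_int by (intro Bochner_Integration.integrable_sum integrable_scaleR_left) auto
  then have "trace (Var_mat M X) = (LINT \<omega>|M. trace (outer (X \<omega> - c)))"
    unfolding Var_mat_def EX by (rule integral_bounded_linear[OF bounded_linear_trace, symmetric])
  moreover have "trace (outer (X \<omega> - c)) = (\<Sum>i\<in>UNIV. (S i \<omega>)\<^sup>2)" for \<omega>
  proof -
    have "trace (outer (X \<omega> - c)) = (X \<omega> - c) \<bullet> (\<Sum>i\<in>UNIV. S i \<omega> *\<^sub>R u i)"
      unfolding trace_outer by (simp add: X)
    then show ?thesis
      by (simp add: inner_sum_right S_def inner_commute[of "X \<omega> - c"] power2_eq_square)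
  qed
  ultimately show ?thesis
    using SS_int unfolding S_def by (simp add: Bochner_Integration.integral_sum power2_eq_square)
qed

section \<open>Empirical means and the law of a sampled index\<close>

lemma strictly_pos_def_invertible:
  assumes "strictly_pos_def A"
  shows "invertible A"
proof -
  have "v = 0" if "A *v v = 0" for v
    using assms that by (metis inner_zero_right order_less_irrefl strictly_pos_def_def)
  then show ?thesis
    by (metis invertible_left_inverse matrix_left_invertible_ker)
qed

lemma bounded_linear_emp_mean:
  assumes "bounded_linear f"
  shows "f (emp_mean n g) = emp_mean n (\<lambda>i. f (g i))"
proof -
  interpret bounded_linear f by fact
  show ?thesis by (simp add: emp_mean_def scaleR sum)
qed

lemma bounded_linear_matrix_vector_mult_left:
  "bounded_linear (\<lambda>A :: real^'n^'m. A *v v)"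
  unfolding linear_conv_bounded_linear[symmetric]
  by (rule linearI) (simp_all add: matrix_vector_mult_add_rdistrib scaleR_matrix_vector_assoc)

text \<open>The noise vectors are the component gradients at \<open>x_star\<close>, where the
  averaged gradient vanishes: \<open>m\<close> solves
  \<open>emp_mean n As *v m = emp_mean n bs\<close>.\<close>

lemma emp_mean_y_noise:
  assumes "strictly_pos_def (emp_mean n As)"
  shows "emp_mean n (y_noise n As bs) = 0"
proof -
  define m where "m = matrix_inv (emp_mean n As) *v emp_mean n bs"
  have "emp_mean n (y_noise n As bs) = emp_mean n bs - emp_mean n (\<lambda>i. As i *v m)"
    by (simp add: emp_mean_def y_noise_def m_def sum_subtractf sum.distrib sum_negf algebra_simps)
  also have "emp_mean n (\<lambda>i. As i *v m) = emp_mean n As *v m"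
    by (rule bounded_linear_emp_mean[symmetric, OF bounded_linear_matrix_vector_mult_left])
  also have "\<dots> = emp_mean n bs"
    unfolding m_def matrix_vector_mul_assoc
    by (simp add: invertible_matrix_inv_right[OF strictly_pos_def_invertible[OF assms]])
  finally show ?thesis by simp
qed

text \<open>The quadratic form of each rank-one term is a square; this identifies the form of
  \<open>Sigma_mat\<close> with the second moment of the projected noise.\<close>

lemma inner_Sigma_mat:
  "v \<bullet> (Sigma_mat n As bs *v v) = emp_mean n (\<lambda>i. (v \<bullet> y_noise n As bs i)\<^sup>2)"
proof -
  have "bounded_linear (\<lambda>N. v \<bullet> (N *v v))"
    by (rule bounded_linear_compose[OF bounded_linear_inner_right bounded_linear_matrix_vector_mult_left])
  from bounded_linear_emp_mean[OF this] show ?thesis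
    by (simp add: Sigma_mat_def inner_outer_mult)
qed

lemma (in prob_space) sampled_with_replacement_expectation:
  fixes f :: "nat \<Rightarrow> real"
  assumes "sampled_with_replacement n M I"
  shows "expectation (\<lambda>\<omega>. f (I k \<omega>)) = emp_mean n f"
proof -
  have I: "I k \<in> measurable M (count_space {1..n})"
    using assms unfolding sampled_with_replacement_def indep_vars_def by blast
  have "expectation (\<lambda>\<omega>. f (I k \<omega>)) = integral\<^sup>L (distr M (count_space {1..n}) (I k)) f"
    by (rule integral_distr[OF I, symmetric]) simp
  also have "\<dots> = integral\<^sup>L (uniform_count_measure {1..n}) f"
    using assms by (simp add: sampled_with_replacement_def)
  also have "\<dots> = emp_mean n f"
    by (simp add: integral_uniform_count_measure emp_mean_def)
  finally show ?thesis .
qed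

theorem mainTheorem1:
  fixes n :: nat
    and As :: "nat \<Rightarrow> real^'d^'d"
    and bs :: "nat \<Rightarrow> real^'d"
    and u :: "'d \<Rightarrow> real^'d"
    and lam :: "'d \<Rightarrow> real"
    and \<alpha> \<gamma> :: real
    and M :: "'w measure"
    and I :: "int \<Rightarrow> 'w \<Rightarrow> nat"
    and x :: "int \<Rightarrow> 'w \<Rightarrow> real^'d"
  assumes "n \<ge> 1"
    and "\<And>i. i \<in> {1..n} \<Longrightarrow> symmetric_mat (As i)"
    and "strictly_pos_def (emp_mean n As)"
    and "\<And>i j. u i \<bullet> u j = (if i = j then 1 else 0)"
    and "\<And>i. emp_mean n As *v u i = lam i *\<^sub>R u i"
    and "\<And>i. lam i > 0"
    and "\<gamma> > 0" and "0 \<le> \<alpha>" and "\<alpha> < 1"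
    and "prob_space M"
    and "sampled_with_replacement n M I"
    and "stationary_sgdm n As bs \<alpha> \<gamma> M I x"
    and "\<And>i. (1 - \<alpha>)\<^sup>2 + \<gamma>\<^sup>2 * (lam i)\<^sup>2 - 2 * (1 + \<alpha>) * \<gamma> * lam i \<ge> 0"
  shows "\<forall>k. trace (Var_mat M (x k)) =
           \<gamma>\<^sup>2 * (\<Sum>i\<in>UNIV. (u i \<bullet> (Sigma_mat n As bs *v u i)) * var_coef \<alpha> \<gamma> (lam i))"
proof
  fix k
  interpret prob_space M by fact
  note sampled = \<open>sampled_with_replacement n M I\<close>
  have sym: "symmetric_mat (emp_mean n As)" using assms(3) by (simp add: strictly_pos_def_def)
  have unit: "u i \<bullet> u i = 1" for i using assms(4) by simp
  obtain H where H: "sgdm_impulse_response \<alpha> \<gamma> (emp_mean n As) H"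
    and conv: "\<And>k \<omega>. \<omega> \<in> space M \<Longrightarrow>
      ((\<lambda>j. H (k - j) *v y_noise n As bs (I j \<omega>)) has_sum (x k \<omega> - x_star n As bs)) UNIV"
    using assms(12) unfolding stationary_sgdm_def by blast
  define h where "h i k = u i \<bullet> (H k *v u i)" for i k
  define y where "y = y_noise n As bs"
  \<comment> \<open>For fixed \<open>i\<close> these projections of the noise are independent,
    centred and bounded in \<open>j\<close>, as the moment lemma asks.\<close>
  define W where "W i j \<omega> = u i \<bullet> y (I j \<omega>)" for i j \<omega>
  note mode = sgdm_impulse_response_mode[OF H sym assms(5) unit, folded h_def]
  have energy: "(\<Sum>\<^sub>\<infinity>j. (h i j)\<^sup>2) = \<gamma>\<^sup>2 * var_coef \<alpha> \<gamma> (lam i)" for i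
    using assms(6-9) assms(13)[of i] mode(1-3)[of i] by (intro momentum_energy) (auto simp: disc_def)
  \<comment> \<open>The convolution weights are \<open>h i (k - j)\<close>. This reversal carries
    summability and energy over from \<open>h i\<close>, which also makes the variance independent
    of \<open>k\<close>.\<close>
  have refl: "bij_betw (\<lambda>j. k - j) UNIV (UNIV :: int set)"
    by (rule bij_betwI[where g = "\<lambda>j. k - j"]) auto
  have moments: "(\<lambda>\<omega>. u i \<bullet> (x k \<omega> - x_star n As bs)) \<in> borel_measurable M"
    "\<exists>C. \<forall>\<omega>\<in>space M. \<bar>u i \<bullet> (x k \<omega> - x_star n As bs)\<bar> \<le> C"
    "expectation (\<lambda>\<omega>. u i \<bullet> (x k \<omega> - x_star n As bs)) = 0"
    "expectation (\<lambda>\<omega>. (u i \<bullet> (x k \<omega> - x_star n As bs))\<^sup>2)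
      = (u i \<bullet> (Sigma_mat n As bs *v u i)) * (\<Sum>\<^sub>\<infinity>j. (h i (k - j))\<^sup>2)" for i
  proof -
    have indep: "indep_vars (\<lambda>_. borel) (W i) UNIV"
      using sampled unfolding W_def sampled_with_replacement_def
      by (intro indep_vars_compose2[where M' = "\<lambda>_. count_space {1..n}" and Y = "\<lambda>_ m. u i \<bullet> y m"]) auto
    have rng: "I j \<omega> \<in> {1..n}" if "\<omega> \<in> space M" for j \<omega>
      using sampled that measurable_space[of "I j" M "count_space {1..n}" \<omega>]
      by (auto simp: sampled_with_replacement_def indep_vars_def)
    \<comment> \<open>An index takes only finitely many values, so the sum over all of them is a
      uniform bound.\<close>
    have W: "\<bar>W i j \<omega>\<bar> \<le> (\<Sum>m = 1..n. \<bar>u i \<bullet> y m\<bar>)" if "\<omega> \<in> space M" for j \<omega>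
      unfolding W_def using rng[OF that, of j] by (intro member_le_sum) auto
    have mean: "expectation (W i j) = 0" for j
    proof -
      have "expectation (W i j) = emp_mean n (\<lambda>m. u i \<bullet> y m)"
        unfolding W_def by (rule sampled_with_replacement_expectation[OF sampled])
      also have "\<dots> = u i \<bullet> emp_mean n y"
        by (rule bounded_linear_emp_mean[OF bounded_linear_inner_right, symmetric])
      finally show ?thesis using emp_mean_y_noise[OF assms(3)] by (simp add: y_def)
    qed
    have var: "expectation (\<lambda>\<omega>. (W i j \<omega>)\<^sup>2) = u i \<bullet> (Sigma_mat n As bs *v u i)" for j
      unfolding W_def inner_Sigma_mat y_def
      by (rule sampled_with_replacement_expectation[OF sampled])
    have abs: "(\<lambda>j. \<bar>h i (k - j)\<bar>) summable_on UNIV"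
      using mode(2)[of i] summable_on_reindex_bij_betw[OF refl, of "\<lambda>j. \<bar>h i j\<bar>"] by simp
    \<comment> \<open>Projecting on \<open>u i\<close> turns the matrix convolution into a scalar
      one by \<open>mode(4)\<close>.\<close>
    have S: "((\<lambda>j. h i (k - j) * W i j \<omega>) has_sum (u i \<bullet> (x k \<omega> - x_star n As bs))) UNIV"
      if "\<omega> \<in> space M" for \<omega>
      using has_sum_bounded_linear[OF bounded_linear_inner_right conv[OF that], of "u i" k]
      by (simp add: o_def mode(4) W_def y_def)
    note * = weighted_series_moments[where S = "\<lambda>\<omega>. u i \<bullet> (x k \<omega> - x_star n As bs)",
        OF indep W mean var abs S]
    show "(\<lambda>\<omega>. u i \<bullet> (x k \<omega> - x_star n As bs)) \<in> borel_measurable M"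
      by (rule *(1))
    show "\<exists>C. \<forall>\<omega>\<in>space M. \<bar>u i \<bullet> (x k \<omega> - x_star n As bs)\<bar> \<le> C"
      by (rule *(2))
    show "expectation (\<lambda>\<omega>. u i \<bullet> (x k \<omega> - x_star n As bs)) = 0"
      by (rule *(3))
    show "expectation (\<lambda>\<omega>. (u i \<bullet> (x k \<omega> - x_star n As bs))\<^sup>2)
        = (u i \<bullet> (Sigma_mat n As bs *v u i)) * (\<Sum>\<^sub>\<infinity>j. (h i (k - j))\<^sup>2)"
      by (rule *(4))
  qed
  have "(\<Sum>\<^sub>\<infinity>j. (h i (k - j))\<^sup>2) = \<gamma>\<^sup>2 * var_coef \<alpha> \<gamma> (lam i)" for i
    using infsum_reindex_bij_betw[OF refl, of "\<lambda>j. (h i j)\<^sup>2"] energy by simp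
  then show "trace (Var_mat M (x k)) =
      \<gamma>\<^sup>2 * (\<Sum>i\<in>UNIV. (u i \<bullet> (Sigma_mat n As bs *v u i)) * var_coef \<alpha> \<gamma> (lam i))"
    using trace_Var_mat_orthonormal[OF assms(4) moments(1-3)] moments(4)
    by (simp add: sum_distrib_left mult_ac)
qed

end
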